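(* The local complexity of the class of penny graphs is $\Theta(n)$.
   Context: A penny graph is the contact graph of pairwise interior-disjoint unit disks in the plane. All graphs are finite, simple, connected; $n$ is the number of vertices, and vertices carry distinct identifiers in $\{1,\dots,\mathrm{poly}(n)\}$. A proof labeling scheme for a class $\mathcal{G}$ consists of a prover assigning a certificate (binary word) to each vertex of each $G\in\mathcal{G}$ and a local verifier in which each vertex accepts or rejects based only on identifiers and certificates in its closed neighborhood; all vertices accept when $G\in\mathcal{G}$ with the prover's certificates, and when $G\notin\mathcal{G}$ some vertex rejects for every certificate assignment. The local complexity of $\mathcal{G}$ is the minimum, over such schemes, of the maximum certificate length used on $n$-vertex graphs of $\mathcal{G}$. *)

theory Defs
  imports Complex_Main
begin

text \<open>Graphs: a vertex set V of natural-number identifiers and an adjacency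
predicate E. An admissible graph (for identifier exponent c) is a finite, nonempty,
simple (irreflexive, symmetric, no edges leaving V), connected graph whose
identifiers lie in {1..n^c}, where n = card V.\<close>

definition admissible_graph :: "nat \<Rightarrow> nat set \<Rightarrow> (nat \<Rightarrow> nat \<Rightarrow> bool) \<Rightarrow> bool" where
  "admissible_graph c V E \<longleftrightarrow>
     finite V \<and> V \<noteq> {} \<and> V \<subseteq> {1..card V ^ c} \<and>
     (\<forall>u v. E u v \<longrightarrow> u \<in> V \<and> v \<in> V) \<and>
     (\<forall>u v. E u v \<longrightarrow> E v u) \<and>
     (\<forall>v. \<not> E v v) \<and>
     (\<forall>u\<in>V. \<forall>v\<in>V. E\<^sup>*\<^sup>* u v)"

text \<open>Penny graph: contact graph of pairwise interior-disjoint unit disks in the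
plane (plane = complex numbers). Disks of radius 1 centred at p u are interior-disjoint
iff the centres are at distance at least 2, and touch iff at distance exactly 2.\<close>

definition penny_graph :: "nat set \<Rightarrow> (nat \<Rightarrow> nat \<Rightarrow> bool) \<Rightarrow> bool" where
  "penny_graph V E \<longleftrightarrow>
     (\<exists>p :: nat \<Rightarrow> complex.
        (\<forall>u\<in>V. \<forall>v\<in>V. u \<noteq> v \<longrightarrow> dist (p u) (p v) \<ge> 2) \<and>
        (\<forall>u\<in>V. \<forall>v\<in>V. u \<noteq> v \<longrightarrow> (E u v \<longleftrightarrow> dist (p u) (p v) = 2)))"

text \<open>A prover maps a graph to a certificate (binary word) per vertex.
A verifier at vertex v sees its own identifier and certificate and the set of
(identifier, certificate) pairs of its neighbours, i.e. its closed neighbourhood.\<close>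

type_synonym prover = "nat set \<Rightarrow> (nat \<Rightarrow> nat \<Rightarrow> bool) \<Rightarrow> nat \<Rightarrow> bool list"
type_synonym verifier = "nat \<Rightarrow> bool list \<Rightarrow> (nat \<times> bool list) set \<Rightarrow> bool"

definition all_accept :: "verifier \<Rightarrow> nat set \<Rightarrow> (nat \<Rightarrow> nat \<Rightarrow> bool) \<Rightarrow> (nat \<Rightarrow> bool list) \<Rightarrow> bool" where
  "all_accept A V E cert \<longleftrightarrow>
     (\<forall>v\<in>V. A v (cert v) {(u, cert u) | u. u \<in> V \<and> E v u})"

definition penny_pls :: "nat \<Rightarrow> prover \<Rightarrow> verifier \<Rightarrow> bool" where
  "penny_pls c P A \<longleftrightarrow>
     (\<forall>V E. admissible_graph c V E \<longrightarrow>
        (penny_graph V E \<longrightarrow> all_accept A V E (P V E)) \<and>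
        (\<not> penny_graph V E \<longrightarrow> (\<forall>cert. \<not> all_accept A V E cert)))"

definition cert_bound :: "nat \<Rightarrow> prover \<Rightarrow> nat \<Rightarrow> nat \<Rightarrow> bool" where
  "cert_bound c P n k \<longleftrightarrow>
     (\<forall>V E. admissible_graph c V E \<and> penny_graph V E \<and> card V = n \<longrightarrow>
        (\<forall>v\<in>V. length (P V E v) \<le> k))"

definition penny_local_complexity :: "nat \<Rightarrow> nat \<Rightarrow> nat" where
  "penny_local_complexity c n =
     (LEAST k. \<exists>P A. penny_pls c P A \<and> cert_bound c P n k)"

end

theory Submission
  imports Defs "HOL-Library.Product_Plus" "HOL-Library.FuncSet"
begin

text \<open>Upper bound: the centres of a penny graph lie in distinct cells of the integer grid, and adjacent
  centres have cells at bounded offset. Hence a walk of length at most 2n through all vertices,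
  annotated with the offsets of the neighbours, describes the graph up to isomorphism as a word of
  length O(n) over a fixed finite alphabet. Every vertex receives this word, its own place in it and
  the identifier of one root. Local checks make the map to the decoded graph a covering, and the
  root identifier forces it to be injective.

  Lower bound: two parallel strips of the triangular lattice, joined at one end, carry bumps on the
  sides facing each other; the lower bumps encode a set x and the upper ones a set y such that
  bumps touch exactly where x and y differ. As the strips are rigid, the graph is a penny graph
  iff x = y. Only four vertices are incident to edges between the two halves, so if certificates were
  short, two sets would share their certificates there and the mixed graph would be accepted.\<close>

section \<open>Lower bound\<close>

lemma card_words_le: "card {l :: bool list. length l \<le> k} \<le> 2 ^ (k + 1)"
proof -
  have "card {l :: bool list. length l \<le> k} = (\<Sum>i\<le>k. 2 ^ i)"
    using card_lists_length_le[of "UNIV :: bool set" k] by simp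
  also have "\<dots> = 2 ^ (k + 1) - 1"
    using sum_power2[of "k + 1"] by (simp add: atLeast0LessThan lessThan_Suc_atMost)
  finally show ?thesis by simp
qed

lemma finite_words_le: "finite {l :: bool list. length l \<le> k}"
  using finite_lists_length_le[of "UNIV :: bool set" k] by simp

text \<open>If \<open>x\<close> and \<open>y\<close> had the same certificates on \<open>I\<close>,
  then using those of \<open>x\<close> on \<open>S\<close> and those of \<open>y\<close> elsewhere
  would give every vertex of \<open>E x y\<close> a view it already has in \<open>E x x\<close> or
  \<open>E y y\<close>, because neighbours across the cut lie in \<open>I\<close>. So a graph that
  is not penny would be accepted. Hence restriction to \<open>I\<close> is injective on
  \<open>X\<close>.\<close>

lemma cut_fooling_bound:
  fixes E :: "'x \<Rightarrow> 'x \<Rightarrow> nat \<Rightarrow> nat \<Rightarrow> bool"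
  assumes adm: "\<And>x y. x \<in> X \<Longrightarrow> y \<in> X \<Longrightarrow> admissible_graph c V (E x y)"
    and penny: "\<And>x. x \<in> X \<Longrightarrow> penny_graph V (E x x)"
    and not_penny: "\<And>x y. x \<in> X \<Longrightarrow> y \<in> X \<Longrightarrow> x \<noteq> y \<Longrightarrow> \<not> penny_graph V (E x y)"
    and left: "\<And>x y u v. x \<in> X \<Longrightarrow> y \<in> X \<Longrightarrow> v \<in> S \<Longrightarrow> E x y v u \<longleftrightarrow> E x x v u"
    and right: "\<And>x y u v. x \<in> X \<Longrightarrow> y \<in> X \<Longrightarrow> v \<notin> S \<Longrightarrow> E x y v u \<longleftrightarrow> E y y v u"
    and cross: "\<And>x y u v. x \<in> X \<Longrightarrow> y \<in> X \<Longrightarrow> E x y v u \<Longrightarrow> (v \<in> S) \<noteq> (u \<in> S) \<Longrightarrow> u \<in> I"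
    and I: "finite I" "I \<subseteq> V"
    and pls: "penny_pls c P A" and bound: "cert_bound c P (card V) k"
  shows "card X \<le> (2 ^ (k + 1)) ^ card I"
proof -
  let ?L = "{l :: bool list. length l \<le> k}"
  define \<phi> where "\<phi> x = restrict (P V (E x x)) I" for x
  have inj: "inj_on \<phi> X"
  proof (rule inj_onI, rule ccontr)
    fix x y assume x: "x \<in> X" and y: "y \<in> X" and eq: "\<phi> x = \<phi> y" and ne: "x \<noteq> y"
    have agree: "P V (E x x) u = P V (E y y) u" if "u \<in> I" for u
      using fun_cong[OF eq, of u] that by (simp add: \<phi>_def)
    define cert where "cert u = (if u \<in> S then P V (E x x) u else P V (E y y) u)" for u
    have acc: "all_accept A V (E z z) (P V (E z z))" if "z \<in> X" for z
      using pls adm[OF that that] penny[OF that] by (simp add: penny_pls_def)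
    have "all_accept A V (E x y) cert"
      unfolding all_accept_def
    proof
      fix v assume v: "v \<in> V"
      show "A v (cert v) {(u, cert u) |u. u \<in> V \<and> E x y v u}"
      proof (cases "v \<in> S")
        case True
        have "{(u, cert u) |u. u \<in> V \<and> E x y v u} = {(u, P V (E x x) u) |u. u \<in> V \<and> E x x v u}"
          using left[OF x y True] cross[OF x y, of v] True agree
          by (auto simp: cert_def)
        then show ?thesis
          using acc[OF x] v True by (simp add: all_accept_def cert_def)
      next
        case False
        have "{(u, cert u) |u. u \<in> V \<and> E x y v u} = {(u, P V (E y y) u) |u. u \<in> V \<and> E y y v u}"
          using right[OF x y False] cross[OF x y, of v] False agree
          by (auto simp: cert_def)
        then show ?thesis
          using acc[OF y] v False by (simp add: all_accept_def cert_def)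
      qed
    qed
    then show False
      using pls adm[OF x y] not_penny[OF x y ne] by (auto simp: penny_pls_def)
  qed
  have "\<phi> ` X \<subseteq> I \<rightarrow>\<^sub>E ?L"
    using bound adm penny I(2) by (fastforce simp: \<phi>_def cert_bound_def)
  then have "card X \<le> card (I \<rightarrow>\<^sub>E ?L)"
    using inj I(1) finite_words_le by (meson card_inj_on_le finite_PiE)
  also have "\<dots> = card ?L ^ card I"
    using I(1) by (simp add: card_funcsetE)
  also have "\<dots> \<le> (2 ^ (k + 1)) ^ card I"
    using card_words_le by (rule power_mono) simp
  finally show ?thesis .
qed

section \<open>The triangular lattice\<close>

definition lattice_adj :: "int \<times> int \<Rightarrow> int \<times> int \<Rightarrow> bool" where
  "lattice_adj a b \<longleftrightarrow> b - a \<in> {(1, 0), (-1, 0), (0, 1), (0, -1), (1, -1), (-1, 1)}"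

lemma lattice_adj_iff:
  "lattice_adj (a, b) (c, d) \<longleftrightarrow>
     d = b \<and> (c = a + 1 \<or> c = a - 1) \<or> d = b + 1 \<and> (c = a \<or> c = a - 1) \<or> d = b - 1 \<and> (c = a \<or> c = a + 1)"
  by (simp add: lattice_adj_def) presburger

text \<open>The basis vectors \<open>2\<close> and \<open>1 + i sqrt 3\<close> have length 2 and
  enclose 60 degrees, so nearest neighbours are at contact distance.\<close>

definition lattice_point :: "int \<times> int \<Rightarrow> complex" where
  "lattice_point a = Complex (2 * fst a + snd a) (sqrt 3 * snd a)"

lemma lattice_adj_sym: "lattice_adj a b \<longleftrightarrow> lattice_adj b a"
proof -
  obtain x y where "b - a = (x, y)" by (cases "b - a")
  moreover from this have "a - b = (- x, - y)" by (metis minus_diff_eq uminus_Pair)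
  ultimately show ?thesis by (auto simp: lattice_adj_def minus_equation_iff)
qed

lemma lattice_adj_irrefl: "\<not> lattice_adj a a"
  by (auto simp: lattice_adj_def zero_prod_def)

text \<open>The norm form of the Eisenstein integers, a quarter of the squared lattice distance.
  \<open>4 * N\<close> is a square plus three times \<open>y\<close> squared, and likewise for
  \<open>x\<close>, so norm 1 leaves only coordinates in -1, 0, 1.\<close>

lemma eisenstein_norm:
  fixes x y :: int
  defines "N \<equiv> x\<^sup>2 + x * y + y\<^sup>2"
  shows "N = 0 \<longleftrightarrow> x = 0 \<and> y = 0"
    and "N \<ge> 0"
    and "N = 1 \<longleftrightarrow> (x, y) \<in> {(1, 0), (-1, 0), (0, 1), (0, -1), (1, -1), (-1, 1)}"
proof -
  define P Q where "P = (2 * x + y)\<^sup>2" and "Q = (2 * y + x)\<^sup>2"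
  define X Y where "X = x\<^sup>2" and "Y = y\<^sup>2"
  have sq: "4 * N = P + 3 * Y" "4 * N = Q + 3 * X"
    by (auto simp: N_def P_def Q_def X_def Y_def power2_eq_square algebra_simps)
  have ge: "P \<ge> 0" "Q \<ge> 0" "X \<ge> 0" "Y \<ge> 0"
    by (simp_all add: P_def Q_def X_def Y_def)
  show "N \<ge> 0" using sq ge by linarith
  show "N = 0 \<longleftrightarrow> x = 0 \<and> y = 0"
  proof
    assume "N = 0"
    then have "X = 0" "Y = 0" using sq ge by linarith+
    then show "x = 0 \<and> y = 0" by (simp add: X_def Y_def)
  qed (simp add: N_def)
  show "N = 1 \<longleftrightarrow> (x, y) \<in> {(1, 0), (-1, 0), (0, 1), (0, -1), (1, -1), (-1, 1)}"
  proof
    assume *: "N = 1"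
    then have "X \<le> 1" "Y \<le> 1" using sq ge by linarith+
    then have "\<bar>x\<bar> \<le> 1" "\<bar>y\<bar> \<le> 1"
      by (simp_all add: abs_square_le_1 X_def Y_def)
    then have "x \<in> {-1, 0, 1}" "y \<in> {-1, 0, 1}" by auto
    with * show "(x, y) \<in> {(1, 0), (-1, 0), (0, 1), (0, -1), (1, -1), (-1, 1)}"
      by (auto simp: N_def)
  qed (auto simp: N_def)
qed

lemma dist_lattice_point:
  assumes "a \<noteq> b"
  shows "dist (lattice_point a) (lattice_point b) \<ge> 2"
    and "dist (lattice_point a) (lattice_point b) = 2 \<longleftrightarrow> lattice_adj a b"
proof -
  obtain x y where xy: "b - a = (x, y)" by (cases "b - a")
  define q where "q = x\<^sup>2 + x * y + y\<^sup>2"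
  have fs: "fst b = fst a + x" "snd b = snd a + y"
    using xy by (cases a; cases b; auto)+
  have "(dist (lattice_point a) (lattice_point b))\<^sup>2 = (2 * x + y)\<^sup>2 + (sqrt 3 * y)\<^sup>2"
    unfolding dist_norm cmod_power2 by (simp add: lattice_point_def fs power2_eq_square algebra_simps)
  also have "\<dots> = 4 * real_of_int q"
    by (simp add: q_def power_mult_distrib) (simp add: power2_eq_square algebra_simps)
  finally have d: "(dist (lattice_point a) (lattice_point b))\<^sup>2 = 4 * real_of_int q" .
  have "(x, y) \<noteq> (0, 0)" using assms xy by (cases a; cases b; auto)
  then have q1: "q \<ge> 1" using eisenstein_norm(1,2)[of x y] by (auto simp: q_def)
  then have "2\<^sup>2 \<le> (dist (lattice_point a) (lattice_point b))\<^sup>2" using d by simp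
  then show "dist (lattice_point a) (lattice_point b) \<ge> 2"
    by (rule power2_le_imp_le) simp
  have "dist (lattice_point a) (lattice_point b) = 2 \<longleftrightarrow> (dist (lattice_point a) (lattice_point b))\<^sup>2 = 2\<^sup>2"
    by (simp only: power2_eq_iff_nonneg zero_le_dist zero_le_numeral)
  also have "\<dots> \<longleftrightarrow> q = 1" using d by simp
  also have "\<dots> \<longleftrightarrow> lattice_adj a b"
    using eisenstein_norm(3)[of x y] by (simp only: q_def lattice_adj_def xy)
  finally show "dist (lattice_point a) (lattice_point b) = 2 \<longleftrightarrow> lattice_adj a b" .
qed

text \<open>Two equilateral triangles on the edge from \<open>b\<close> to \<open>c\<close> have
  apexes that coincide or are mirror images, and \<open>a \<noteq> d\<close> excludes the former.
  All rigidity below comes from this.\<close>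

lemma rhombus:
  fixes a b c d :: complex
  assumes "dist a b = 2" "dist a c = 2" "dist b c = 2" "dist b d = 2" "dist c d = 2" "a \<noteq> d"
  shows "d = b + c - a"
proof -
  have sq: "(Re (z - w))\<^sup>2 + (Im (z - w))\<^sup>2 = 4" if "dist z w = 2" for z w
    using that cmod_power2[of "z - w"] by (simp add: dist_norm)
  define u1 u2 v1 v2 w1 w2 where "u1 = Re (c - b)" "u2 = Im (c - b)" "v1 = Re (a - b)" "v2 = Im (a - b)"
    "w1 = Re (d - b)" "w2 = Im (d - b)"
  note defs = this
  have u: "u1\<^sup>2 + u2\<^sup>2 = 4" and v: "v1\<^sup>2 + v2\<^sup>2 = 4" and w: "w1\<^sup>2 + w2\<^sup>2 = 4"
    and vu: "(v1 - u1)\<^sup>2 + (v2 - u2)\<^sup>2 = 4" and wu: "(w1 - u1)\<^sup>2 + (w2 - u2)\<^sup>2 = 4"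
    using sq[of c b] sq[of a b] sq[of d b] sq[of a c] sq[of d c] assms
    by (simp_all add: defs dist_commute)
  \<comment> \<open>Both apexes have inner product 2 with the edge vector \<open>(u1, u2)\<close>;
    the cross products \<open>s\<close> and \<open>t\<close> then have equal squares, so only a sign
    is open.\<close>
  define s t where "s = u1 * v2 - u2 * v1" and "t = u1 * w2 - u2 * w1"
  have dv: "u1 * v1 + u2 * v2 = 2" and dw: "u1 * w1 + u2 * w2 = 2"
    using u v w vu wu by (simp_all add: power2_eq_square algebra_simps)
  have "s\<^sup>2 = 12"
  proof -
    have "s\<^sup>2 = (u1\<^sup>2 + u2\<^sup>2) * (v1\<^sup>2 + v2\<^sup>2) - (u1 * v1 + u2 * v2)\<^sup>2"
      by (simp add: s_def power2_eq_square algebra_simps)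
    then show ?thesis unfolding u v dv by simp
  qed
  moreover have "t\<^sup>2 = 12"
  proof -
    have "t\<^sup>2 = (u1\<^sup>2 + u2\<^sup>2) * (w1\<^sup>2 + w2\<^sup>2) - (u1 * w1 + u2 * w2)\<^sup>2"
      by (simp add: t_def power2_eq_square algebra_simps)
    then show ?thesis unfolding u w dw by simp
  qed
  ultimately have "s = t \<or> s = - t" by (metis power2_eq_iff)
  \<comment> \<open>A plane vector is recovered from its inner and cross products with
    \<open>(u1, u2)\<close>.\<close>
  have frame: "(u1\<^sup>2 + u2\<^sup>2) * y = (u1 * y + u2 * z) * u1 - (u1 * z - u2 * y) * u2"
    "(u1\<^sup>2 + u2\<^sup>2) * z = (u1 * y + u2 * z) * u2 + (u1 * z - u2 * y) * u1" for y z
    by (simp_all add: power2_eq_square algebra_simps)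
  have cv: "4 * v1 = 2 * u1 - s * u2" "4 * v2 = 2 * u2 + s * u1"
    using frame[where y = v1 and z = v2] unfolding u dv s_def[symmetric] by simp_all
  have cw: "4 * w1 = 2 * u1 - t * u2" "4 * w2 = 2 * u2 + t * u1"
    using frame[where y = w1 and z = w2] unfolding u dw t_def[symmetric] by simp_all
  from \<open>s = t \<or> s = - t\<close> show ?thesis
  proof
    assume "s = t"
    then have "v1 = w1" "v2 = w2" using cv cw by auto
    then have "a = d" by (simp add: defs complex_eq_iff)
    then show ?thesis using assms by simp
  next
    assume "s = - t"
    then have "w1 = u1 - v1" "w2 = u2 - v2" using cv cw by auto
    then show ?thesis by (simp add: defs complex_eq_iff algebra_simps)
  qed
qed


section \<open>The strips with bumps\<close>

datatype vertex = Frame int int | BumpA nat | BumpB nat | Pad nat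

text \<open>Rows 0, 1 and rows 4, 5 are the strips, columns 0, 1 of rows 2, 3 the joint; the rest of
  rows 2 and 3 is left to the bumps.\<close>

definition frame :: "nat \<Rightarrow> (int \<times> int) set" where
  "frame m = {0..<4 * int m + 4} \<times> {0, 1, 4, 5} \<union> {0, 1} \<times> {2, 3}"

definition core :: "nat \<Rightarrow> vertex set" where
  "core m = (\<lambda>(i, j). Frame i j) ` frame m \<union> BumpA ` {..<m} \<union> BumpB ` {..<m}"

text \<open>The pads form a tail that fills the graph up to \<open>n\<close> vertices.\<close>

definition vertices :: "nat \<Rightarrow> nat \<Rightarrow> vertex set" where
  "vertices m n = core m \<union> Pad ` {..<n - card (core m)}"

text \<open>The opposite conventions for \<open>x\<close> and \<open>y\<close> put the two bumps of
  a bit into the same column, hence in contact, iff the bit differs; otherwise they are two columns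
  apart. The period 4 keeps bumps of different bits apart.\<close>

fun position :: "nat set \<Rightarrow> nat set \<Rightarrow> vertex \<Rightarrow> int \<times> int" where
  "position x y (Frame i j) = (i, j)"
| "position x y (BumpA i) = (4 * int i + (if i \<in> x then 6 else 4), 2)"
| "position x y (BumpB i) = (4 * int i + (if i \<in> y then 4 else 6), 3)"
| "position x y (Pad t) = (- 1 - int t, 0)"

fun clash :: "vertex \<Rightarrow> vertex \<Rightarrow> bool" where
  "clash (BumpA i) (BumpB j) = True"
| "clash (BumpB i) (BumpA j) = True"
| "clash _ _ = False"

text \<open>The bumps of the two sides are never joined by an edge, even where they touch: this is what
  makes the graphs with x distinct from y fail to be penny graphs.\<close>

definition edge :: "nat set \<Rightarrow> nat set \<Rightarrow> vertex \<Rightarrow> vertex \<Rightarrow> bool" where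
  "edge x y u v \<longleftrightarrow> lattice_adj (position x y u) (position x y v) \<and> \<not> clash u v"

fun lower_side :: "vertex \<Rightarrow> bool" where
  "lower_side (Frame i j) \<longleftrightarrow> j \<le> 3"
| "lower_side (BumpA i) \<longleftrightarrow> True"
| "lower_side (BumpB i) \<longleftrightarrow> False"
| "lower_side (Pad t) \<longleftrightarrow> True"

text \<open>Endpoints of the edges between rows 3 and 4 of the joint, the only edges joining the two
  halves.\<close>

definition interface :: "vertex set" where
  "interface = {Frame 0 3, Frame 1 3, Frame 0 4, Frame 1 4}"

lemma finite_frame: "finite (frame m)"
  by (simp add: frame_def)

lemma card_core: "card (core m) \<le> 18 * m + 20"
proof -
  have "card ({0..<4 * int m + 4} \<times> {0, 1, 4, 5 :: int}) = (4 * m + 4) * 4"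
    by (simp add: card_cartesian_product nat_add_distrib nat_mult_distrib)
  moreover have "card ({0, 1} \<times> {2, 3} :: (int \<times> int) set) = 4"
    by (simp add: card_cartesian_product)
  ultimately have "card (frame m) \<le> (4 * m + 4) * 4 + 4"
    unfolding frame_def by (metis card_Un_le)
  then have "card ((\<lambda>(i, j). Frame i j) ` frame m) \<le> 16 * m + 20"
    by (intro order_trans[OF card_image_le[OF finite_frame]]) simp
  moreover have "card (BumpA ` {..<m}) = m" "card (BumpB ` {..<m}) = m"
    by (simp_all add: card_image inj_on_def)
  ultimately show ?thesis
    unfolding core_def
    using card_Un_le[of "(\<lambda>(i, j). Frame i j) ` frame m" "BumpA ` {..<m}"]
      card_Un_le[of "(\<lambda>(i, j). Frame i j) ` frame m \<union> BumpA ` {..<m}" "BumpB ` {..<m}"]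
    by linarith
qed

lemma finite_core: "finite (core m)"
  by (simp add: core_def finite_frame)

lemma finite_vertices: "finite (vertices m n)"
  by (simp add: vertices_def finite_core)

lemma card_vertices:
  assumes "card (core m) \<le> n"
  shows "card (vertices m n) = n"
proof -
  have "core m \<inter> Pad ` {..<n - card (core m)} = {}" by (auto simp: core_def)
  moreover have "card (Pad ` {..<n - card (core m)}) = n - card (core m)"
    by (simp add: card_image inj_on_def)
  ultimately show ?thesis
    using assms by (simp add: vertices_def card_Un_disjoint finite_core)
qed

lemma mem_vertices [simp]:
  "Frame i j \<in> vertices m n \<longleftrightarrow> (i, j) \<in> frame m"
  "BumpA k \<in> vertices m n \<longleftrightarrow> k < m"
  "BumpB k \<in> vertices m n \<longleftrightarrow> k < m"
  "Pad k \<in> vertices m n \<longleftrightarrow> k < n - card (core m)"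
  by (auto simp: vertices_def core_def)

lemma interface_vertices: "interface \<subseteq> vertices m n"
  by (auto simp: interface_def frame_def)

lemma card_interface: "finite interface" "card interface = 4"
  by (simp_all add: interface_def)

lemma clash_sym: "clash u v \<longleftrightarrow> clash v u"
  by (cases u; cases v) auto

lemma edge_sym: "edge x y u v \<longleftrightarrow> edge x y v u"
  using lattice_adj_sym clash_sym by (auto simp: edge_def)

lemma edge_irrefl: "\<not> edge x y v v"
  by (simp add: edge_def lattice_adj_irrefl)

text \<open>The joint lies in columns 0 and 1 while bumps start in column 4, so across the cut a
  bump could meet only bumps, which \<open>clash\<close> forbids. Thus neighbourhoods in the lower
  half are independent of \<open>y\<close>, and those in the upper half of \<open>x\<close>.\<close>

lemma no_crossing_bump:
  assumes "v \<in> vertices m n"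
  shows "lower_side v \<Longrightarrow> \<not> edge x y v (BumpB k)"
    and "\<not> lower_side v \<Longrightarrow> \<not> edge x y v (BumpA k)"
  using assms by (cases v; auto simp: edge_def lattice_adj_iff frame_def)+

lemma edge_lower:
  assumes "v \<in> vertices m n" "lower_side v"
  shows "edge x y v u \<longleftrightarrow> edge x x v u"
proof (cases u)
  case (BumpB k)
  then show ?thesis using no_crossing_bump(1)[OF assms] by simp
qed (use assms(2) in \<open>cases v; simp add: edge_def\<close>)+

lemma edge_upper:
  assumes "v \<in> vertices m n" "\<not> lower_side v"
  shows "edge x y v u \<longleftrightarrow> edge y y v u"
proof (cases u)
  case (BumpA k)
  then show ?thesis using no_crossing_bump(2)[OF assms] by simp
qed (use assms(2) in \<open>cases v; simp add: edge_def\<close>)+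

lemma crossing_edge_interface:
  assumes "u \<in> vertices m n" "v \<in> vertices m n" "edge x y v u" "lower_side v \<noteq> lower_side u"
  shows "u \<in> interface"
proof -
  have frames: "Frame i' j' \<in> interface"
    if "(i, j) \<in> frame m" "(i', j') \<in> frame m" "lattice_adj (i, j) (i', j')" "(j \<le> 3) \<noteq> (j' \<le> 3)"
    for i j i' j'
  proof -
    have nonneg: "a \<ge> 0" and row3: "b = 3 \<longrightarrow> a = 0 \<or> a = 1" if "(a, b) \<in> frame m" for a b
      using that by (auto simp: frame_def)
    have "j = 3 \<and> j' = 4 \<and> (i' = i \<or> i' = i - 1) \<or> j = 4 \<and> j' = 3"
      using that(3,4) unfolding lattice_adj_iff by presburger
    then show ?thesis
      using row3[OF that(1)] row3[OF that(2)] nonneg[OF that(2)] by (auto simp: interface_def)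
  qed
  have uv: "edge x y u v" using assms(3) edge_sym by simp
  have "\<exists>i j. v = Frame i j"
    using assms(4) no_crossing_bump[OF assms(1), of x y] uv by (cases v; cases u; auto simp: edge_def lattice_adj_iff)
  moreover have "\<exists>i j. u = Frame i j"
    using assms(4) no_crossing_bump[OF assms(2), of x y] assms(3) by (cases u; cases v; auto simp: edge_def lattice_adj_iff)
  ultimately show ?thesis
    using frames assms by (auto simp: edge_def)
qed

lemma inj_position: "inj_on (position x x) (vertices m n)"
proof (rule inj_onI)
  fix u v assume "u \<in> vertices m n" "v \<in> vertices m n" "position x x u = position x x v"
  then show "u = v"
    by (cases u; cases v; auto simp: frame_def split: if_splits; presburger)
qed

text \<open>When both sides encode the same set, a lower and an upper bump lie in distinct even
  columns, so at least 2 apart: \<open>clash\<close> then deletes no contact.\<close>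

lemma not_clash_diag:
  assumes "clash u v"
  shows "\<not> lattice_adj (position x x u) (position x x v)"
  using assms
  by (cases u; cases v; auto simp: lattice_adj_iff split: if_splits; presburger)

lemma penny_edge_diag:
  assumes "u \<in> vertices m n" "v \<in> vertices m n" "u \<noteq> v"
  shows "dist (lattice_point (position x x u)) (lattice_point (position x x v)) \<ge> 2"
    and "edge x x u v \<longleftrightarrow> dist (lattice_point (position x x u)) (lattice_point (position x x v)) = 2"
  using dist_lattice_point[of "position x x u" "position x x v"] assms inj_position[of x m n]
    not_clash_diag[of u v x]
  by (auto simp: edge_def dest: inj_onD)

text \<open>Rows lead left to column 0 and column 0 leads down; a bump rests on its strip, and the
  pads lead right to the corner.\<close>

lemma edge_connected:
  fixes x y :: "nat set"
  assumes "v \<in> vertices m n"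
  defines "E \<equiv> \<lambda>u v. u \<in> vertices m n \<and> v \<in> vertices m n \<and> edge x y u v"
  shows "E\<^sup>*\<^sup>* v (Frame 0 0)"
proof -
  have down: "E\<^sup>*\<^sup>* (Frame 0 (int k)) (Frame 0 0)" if "k \<le> 5" for k
    using that
  proof (induction k)
    case (Suc k)
    have "int k \<in> {0, 1, 2, 3, 4}" using Suc.prems by auto
    then have "E (Frame 0 (int (Suc k))) (Frame 0 (int k))"
      by (auto simp: E_def frame_def edge_def lattice_adj_iff)
    then show ?case using Suc by (meson Suc_leD converse_rtranclp_into_rtranclp)
  qed simp
  have left: "E\<^sup>*\<^sup>* (Frame (int k) j) (Frame 0 j)" if "(int k, j) \<in> frame m" for k j
    using that
  proof (induction k)
    case (Suc k)
    then have "(int k, j) \<in> frame m" by (auto simp: frame_def)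
    moreover from this have "E (Frame (int (Suc k)) j) (Frame (int k) j)"
      using Suc.prems by (auto simp: E_def edge_def lattice_adj_iff)
    ultimately show ?case using Suc by (meson converse_rtranclp_into_rtranclp)
  qed simp
  have fr: "E\<^sup>*\<^sup>* (Frame i j) (Frame 0 0)" if "(i, j) \<in> frame m" for i j
  proof -
    have "i = int (nat i)" "j = int (nat j)" "nat j \<le> 5" using that by (auto simp: frame_def)
    then show ?thesis using left[of "nat i" j] down[of "nat j"] that by (metis rtranclp_trans)
  qed
  show ?thesis
  proof (cases v)
    case (Frame i j)
    then show ?thesis using fr assms(1) by simp
  next
    case (BumpA k)
    let ?i = "4 * int k + (if k \<in> x then 6 else 4)"
    have "(?i, 1) \<in> frame m" using assms(1) BumpA by (auto simp: frame_def)
    moreover from this have "E v (Frame ?i 1)"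
      using assms(1) BumpA by (auto simp: E_def edge_def lattice_adj_iff)
    ultimately show ?thesis using fr by (meson converse_rtranclp_into_rtranclp)
  next
    case (BumpB k)
    let ?i = "4 * int k + (if k \<in> y then 4 else 6)"
    have "(?i, 4) \<in> frame m" using assms(1) BumpB by (auto simp: frame_def)
    moreover from this have "E v (Frame ?i 4)"
      using assms(1) BumpB by (auto simp: E_def edge_def lattice_adj_iff)
    ultimately show ?thesis using fr by (meson converse_rtranclp_into_rtranclp)
  next
    case (Pad k)
    have "E\<^sup>*\<^sup>* (Pad k) (Frame 0 0)" if "k < n - card (core m)" for k
      using that
    proof (induction k)
      case 0
      then have "E (Pad 0) (Frame 0 0)"
        by (auto simp: E_def edge_def lattice_adj_iff frame_def)
      then show ?case by auto
    next
      case (Suc k)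
      then have "E (Pad (Suc k)) (Pad k)"
        by (auto simp: E_def edge_def lattice_adj_iff)
      then show ?case using Suc by (meson Suc_lessD converse_rtranclp_into_rtranclp)
    qed
    then show ?thesis using assms(1) Pad by simp
  qed
qed

section \<open>Rigidity of the strips\<close>

text \<open>A contact realisation of the frame is congruent to the lattice, so the two bumps belonging
  to a bit on which x and y differ are forced to touch.\<close>

lemma not_penny_off_diagonal:
  fixes P :: "vertex \<Rightarrow> complex"
  assumes x: "x \<subseteq> {..<m}" and y: "y \<subseteq> {..<m}" and ne: "x \<noteq> y"
    and P: "\<And>u v. u \<in> vertices m n \<Longrightarrow> v \<in> vertices m n \<Longrightarrow> u \<noteq> v \<Longrightarrow>
      dist (P u) (P v) \<ge> 2 \<and> (edge x y u v \<longleftrightarrow> dist (P u) (P v) = 2)"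
  shows False
proof -
  let ?V = "vertices m n"
  \<comment> \<open>Three vertices at the corner determine an affine image of the lattice;
    \<open>placed v\<close> says that \<open>v\<close> sits where this image predicts.\<close>
  define e1 e2 where "e1 = P (Frame 1 0) - P (Frame 0 0)" and "e2 = P (Frame 0 1) - P (Frame 0 0)"
  define aff where "aff a = P (Frame 0 0) + of_int (fst a) * e1 + of_int (snd a) * e2" for a :: "int \<times> int"
  define placed where "placed v \<longleftrightarrow> v \<in> ?V \<and> P v = aff (position x y v)" for v
  have dist2: "dist (P u) (P v) = 2" if "edge x y u v" "u \<in> ?V" "v \<in> ?V" for u v
    using P[OF that(2,3)] that(1) edge_irrefl by metis
  have rhomb: "placed d"
    if "placed a" "placed b" "placed c" "d \<in> ?V" "edge x y a b" "edge x y a c" "edge x y b c"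
      "edge x y b d" "edge x y c d" "position x y d = position x y b + position x y c - position x y a" 
      "a \<noteq> d"
    for a b c d
  proof -
    have V: "a \<in> ?V" "b \<in> ?V" "c \<in> ?V" using that by (auto simp: placed_def)
    have "P a \<noteq> P d" using P[OF V(1) that(4,11)] by auto
    then have "P d = P b + P c - P a"
      using that dist2 V by (intro rhombus) auto
    moreover have "fst (position x y d) = fst (position x y b) + fst (position x y c) - fst (position x y a)"
      "snd (position x y d) = snd (position x y b) + snd (position x y c) - snd (position x y a)"
      using that(10) by simp_all
    ultimately show ?thesis
      using that(1-4) by (simp add: placed_def aff_def ring_distribs)
  qed
  note sets = frame_def edge_def lattice_adj_iff
  have base: "placed (Frame 0 0)" "placed (Frame 1 0)" "placed (Frame 0 1)"
    by (simp_all add: placed_def aff_def e1_def e2_def frame_def)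
  have row1: "placed (Frame 1 1)"
    using base by (rule rhomb) (auto simp: sets)
  \<comment> \<open>Going up columns 0 and 1, the joint carries the placement from the lower strip
    to the upper one.\<close>
  have columns: "placed (Frame 0 (int j)) \<and> placed (Frame 1 (int j)) \<and>
      placed (Frame 0 (int j + 1)) \<and> placed (Frame 1 (int j + 1))" if "j \<le> 4" for j
    using that
  proof (induction j)
    case 0
    show ?case using base row1 by simp
  next
    case (Suc j)
    have j: "int j \<in> {0, 1, 2, 3}" using Suc.prems by auto
    have IH: "placed (Frame 0 (int j))" "placed (Frame 1 (int j))" "placed (Frame 0 (int j + 1))"
      "placed (Frame 1 (int j + 1))" using Suc by auto
    have 0: "placed (Frame 0 (int j + 2))"
      by (rule rhomb[OF IH(2,3,4)]) (use j in \<open>auto simp: sets\<close>)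
    have "placed (Frame 1 (int j + 2))"
      by (rule rhomb[OF IH(3,4) 0]) (use j in \<open>auto simp: sets\<close>)
    then show ?case using IH 0 by (simp add: add.commute add.left_commute)
  qed
  \<comment> \<open>Each strip is then filled to the right, \<open>j\<close> being its lower
    row.\<close>
  have strip: "placed (Frame (int i) j) \<and> placed (Frame (int i + 1) j) \<and>
      placed (Frame (int i) (j + 1)) \<and> placed (Frame (int i + 1) (j + 1))"
    if "i < 4 * m + 3" "j \<in> {0, 4}" for i j
    using that(1)
  proof (induction i)
    case 0
    show ?case using columns[of "nat j"] that(2) by auto
  next
    case (Suc i)
    have i: "int i + 2 < 4 * int m + 4" using Suc.prems by linarith
    have IH: "placed (Frame (int i) j)" "placed (Frame (int i + 1) j)" "placed (Frame (int i) (j + 1))"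
      "placed (Frame (int i + 1) (j + 1))" using Suc by auto
    have 0: "placed (Frame (int i + 2) j)"
      by (rule rhomb[OF IH(3,2,4)]) (use i that(2) in \<open>auto simp: sets\<close>)
    have "placed (Frame (int i + 2) (j + 1))"
      by (rule rhomb[OF IH(2) 0 IH(4)]) (use i that(2) in \<open>auto simp: sets\<close>)
    then show ?case using IH 0 by (simp add: add.commute add.left_commute)
  qed
  \<comment> \<open>The last column has no strip step of its own and comes from index
    \<open>4 * m + 2\<close>.\<close>
  have frame_placed: "placed (Frame i j)" if "i \<ge> 0" "i < 4 * int m + 4" "j \<in> {0, 1, 4, 5}" for i j
  proof (cases "i = 4 * int m + 3")
    case True
    then show ?thesis using strip[of "4 * m + 2" 0] strip[of "4 * m + 2" 4] that(3) by (auto simp: add.commute)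
  next
    case False
    then show ?thesis using strip[of "nat i" 0] strip[of "nat i" 4] that by auto
  qed
  \<comment> \<open>A bump touches two consecutive vertices of its strip and closes a rhombus with a
    third vertex behind them.\<close>
  have bumpA: "placed (BumpA k)" if "k < m" for k
  proof -
    define i where "i = 4 * int k + (if k \<in> x then 6 else 4)"
    have i: "i > 0" "i + 1 < 4 * int m + 4" using that by (auto simp: i_def)
    have "placed (Frame (i + 1) 0)" "placed (Frame i 1)" "placed (Frame (i + 1) 1)"
      using frame_placed i by auto
    then show ?thesis
      by (rule rhomb) (use i that in \<open>auto simp: sets i_def\<close>)
  qed
  have bumpB: "placed (BumpB k)" if "k < m" for k
  proof -
    define i where "i = 4 * int k + (if k \<in> y then 4 else 6)"
    have i: "i > 0" "i + 1 < 4 * int m + 4" using that by (auto simp: i_def)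
    have "placed (Frame (i - 1) 5)" "placed (Frame (i - 1) 4)" "placed (Frame i 4)"
      using frame_placed i by auto
    then show ?thesis
      by (rule rhomb) (use i that in \<open>auto simp: sets i_def\<close>)
  qed
  \<comment> \<open>At a differing bit the bumps must be \<open>e2\<close> apart, a vector of length
    2, yet \<open>clash\<close> denies them the edge.\<close>
  obtain k where k: "k < m" "(k \<in> x) \<noteq> (k \<in> y)" using x y ne by blast
  have "P (BumpB k) - P (BumpA k) = e2"
    using bumpA[OF k(1)] bumpB[OF k(1)] k(2) by (auto simp: placed_def aff_def algebra_simps)
  moreover have "dist (P (Frame 0 0)) (P (Frame 0 1)) = 2"
    by (rule dist2) (auto simp: sets)
  ultimately have "dist (P (BumpA k)) (P (BumpB k)) = 2"
    by (metis dist_commute dist_norm e2_def)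
  then show False using P[of "BumpA k" "BumpB k"] k(1) by (simp add: edge_def)
qed

section \<open>Linear certificates are necessary\<close>

text \<open>The \<open>2 ^ m\<close> subsets of \<open>{..<m}\<close> need distinct certificates on
  4 vertices, each having at most \<open>2 ^ (k + 1)\<close> choices.\<close>

lemma cert_bound_lower:
  assumes c: "c \<ge> 1" and m: "18 * m + 20 \<le> n"
    and pls: "penny_pls c Pr A" and bound: "cert_bound c Pr n k"
  shows "m \<le> 4 * (k + 1)"
proof -
  let ?V = "vertices m n"
  have cardV: "card ?V = n" using card_core[of m] m by (intro card_vertices) simp
  \<comment> \<open>The vertex set does not depend on \<open>x\<close> and \<open>y\<close>, so one
    assignment of identifiers serves all pairs.\<close>
  then obtain g where g: "bij_betw g {1..n} ?V"
    using finite_same_card_bij[of "{1..n}" ?V] finite_vertices by auto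
  define h where "h = inv_into {1..n} g"
  have h: "bij_betw h ?V {1..n}" using bij_betw_inv_into[OF g] by (simp add: h_def)
  have hg: "h (g a) = a" if "a \<in> {1..n}" for a
    using bij_betw_inv_into_left[OF g that] by (simp add: h_def)
  have gh: "g (h v) = v" if "v \<in> ?V" for v
    using bij_betw_inv_into_right[OF g that] by (simp add: h_def)
  have gV: "g a \<in> ?V" if "a \<in> {1..n}" for a using bij_betwE[OF g] that by blast
  have hV: "h v \<in> {1..n}" if "v \<in> ?V" for v using bij_betwE[OF h] that by blast
  define E where "E x y a b \<longleftrightarrow> a \<in> {1..n} \<and> b \<in> {1..n} \<and> edge x y (g a) (g b)" for x y a b
  have adm: "admissible_graph c {1..n} (E x y)" for x y
  proof -
    have "n \<le> n ^ c" using c by (cases "n = 0") (auto intro: self_le_power)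
    have reach: "(E x y)\<^sup>*\<^sup>* (h u) (h v)" if "(\<lambda>u v. u \<in> ?V \<and> v \<in> ?V \<and> edge x y u v)\<^sup>*\<^sup>* u v" for u v
      using that
    proof (induction rule: rtranclp_induct)
      case (step v w)
      then have "E x y (h v) (h w)" using hV gh by (auto simp: E_def)
      with step.IH show ?case by (rule rtranclp.rtrancl_into_rtrancl)
    qed simp
    have root: "(E x y)\<^sup>*\<^sup>* a (h (Frame 0 0))" if "a \<in> {1..n}" for a
      using reach[OF edge_connected[OF gV[OF that]]] hg[OF that] by simp
    have sym: "symp (E x y)" using edge_sym by (auto simp: E_def symp_def)
    have "(E x y)\<^sup>*\<^sup>* a b" if "a \<in> {1..n}" "b \<in> {1..n}" for a b
      using root[OF that(1)] sympD[OF symp_rtranclp[OF sym] root[OF that(2)]] by (rule rtranclp_trans)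
    then show ?thesis
      using m \<open>n \<le> n ^ c\<close> sym edge_irrefl by (auto simp: admissible_graph_def E_def symp_def)
  qed
  have penny: "penny_graph {1..n} (E x x)" for x
    unfolding penny_graph_def
  proof (intro exI[of _ "lattice_point \<circ> position x x \<circ> g"] conjI ballI impI)
    fix a b assume ab: "a \<in> {1..n}" "b \<in> {1..n}" "a \<noteq> b"
    then have "g a \<noteq> g b" using hg by metis
    from penny_edge_diag[OF gV[OF ab(1)] gV[OF ab(2)] this, of x]
    show "2 \<le> dist ((lattice_point \<circ> position x x \<circ> g) a) ((lattice_point \<circ> position x x \<circ> g) b)"
      "E x x a b \<longleftrightarrow> dist ((lattice_point \<circ> position x x \<circ> g) a) ((lattice_point \<circ> position x x \<circ> g) b) = 2"
      using ab by (simp_all add: E_def)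
  qed
  have not_penny: "\<not> penny_graph {1..n} (E x y)" if xy: "x \<in> Pow {..<m}" "y \<in> Pow {..<m}" "x \<noteq> y" for x y
  proof
    assume "penny_graph {1..n} (E x y)"
    then obtain p :: "nat \<Rightarrow> complex" where p: "\<forall>a\<in>{1..n}. \<forall>b\<in>{1..n}. a \<noteq> b \<longrightarrow> dist (p a) (p b) \<ge> 2"
      "\<forall>a\<in>{1..n}. \<forall>b\<in>{1..n}. a \<noteq> b \<longrightarrow> (E x y a b \<longleftrightarrow> dist (p a) (p b) = 2)"
      unfolding penny_graph_def by blast
    show False
    proof (rule not_penny_off_diagonal[of x m y n "p \<circ> h"])
      fix u v assume uv: "u \<in> ?V" "v \<in> ?V" "u \<noteq> v"
      then have "h u \<noteq> h v" using gh by metis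
      moreover have "E x y (h u) (h v) \<longleftrightarrow> edge x y u v"
        using uv hV gh by (simp add: E_def)
      ultimately show "dist ((p \<circ> h) u) ((p \<circ> h) v) \<ge> 2 \<and>
          (edge x y u v \<longleftrightarrow> dist ((p \<circ> h) u) ((p \<circ> h) v) = 2)"
        using p hV[OF uv(1)] hV[OF uv(2)] by simp
    qed (use xy in auto)
  qed
  have "card (Pow {..<m}) \<le> (2 ^ (k + 1)) ^ card (h ` interface)"
  proof (rule cut_fooling_bound[where E = E and S = "{a. lower_side (g a)}" and V = "{1..n}"])
    show "E x y v u \<longleftrightarrow> E x x v u" if "v \<in> {a. lower_side (g a)}" for x y u v
      using edge_lower[OF gV] that by (auto simp: E_def)
    show "E x y v u \<longleftrightarrow> E y y v u" if "v \<notin> {a. lower_side (g a)}" for x y u v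
      using edge_upper[OF gV] that by (auto simp: E_def)
    show "u \<in> h ` interface"
      if "E x y v u" "(v \<in> {a. lower_side (g a)}) \<noteq> (u \<in> {a. lower_side (g a)})" for x y u v
    proof -
      have "u \<in> {1..n}" "v \<in> {1..n}" "edge x y (g v) (g u)" using that(1) by (auto simp: E_def)
      then have "g u \<in> interface" using crossing_edge_interface[OF gV gV] that(2) by blast
      then show ?thesis using hg[OF \<open>u \<in> {1..n}\<close>] by (metis imageI)
    qed
    show "h ` interface \<subseteq> {1..n}" using interface_vertices hV by blast
    show "cert_bound c Pr (card {1..n}) k" using bound by simp
  qed (use adm penny not_penny card_interface pls in auto)
  moreover have "card (h ` interface) \<le> 4"
    using card_image_le[OF card_interface(1), of h] card_interface(2) by simp
  ultimately have "(2::nat) ^ m \<le> (2 ^ (k + 1)) ^ 4"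
  proof -
    assume *: "card (Pow {..<m}) \<le> (2 ^ (k + 1)) ^ card (h ` interface)" "card (h ` interface) \<le> 4"
    have "(2::nat) ^ m = card (Pow {..<m})" by (simp add: card_Pow)
    also note *(1)
    also have "((2::nat) ^ (k + 1)) ^ card (h ` interface) \<le> (2 ^ (k + 1)) ^ 4"
      using *(2) by (intro power_increasing) simp_all
    finally show ?thesis .
  qed
  then have "(2::nat) ^ m \<le> 2 ^ ((k + 1) * 4)" by (simp only: power_mult)
  then have "m \<le> (k + 1) * 4" by (rule power_le_imp_le_exp[rotated]) simp
  then show ?thesis by simp
qed

section \<open>Upper bound\<close>

lemma rtranclp_exit:
  assumes "E\<^sup>*\<^sup>* a b" "a \<in> S" "b \<notin> S"
  obtains u v where "u \<in> S" "v \<notin> S" "E u v"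
  using assms by (induction rule: rtranclp_induct) blast+

text \<open>While a vertex is missing, some edge from \<open>u\<close> to \<open>v\<close> leaves
  the visited set. Replacing an occurrence of \<open>u\<close> by \<open>u, v, u\<close> keeps the
  head and adds one vertex for two entries, so \<open>k + 1\<close> vertices take
  \<open>2 * k + 1\<close> entries.\<close>

lemma covering_walk:
  assumes fin: "finite V" and r: "r \<in> V" and E: "\<And>u v. E u v \<Longrightarrow> u \<in> V \<and> v \<in> V"
    "\<And>u v. E u v \<Longrightarrow> E v u" and conn: "\<And>v. v \<in> V \<Longrightarrow> E\<^sup>*\<^sup>* r v"
  obtains ws where "ws \<noteq> []" "hd ws = r" "set ws = V" "successively E ws" "length ws \<le> 2 * card V"
proof -
  have "\<exists>ws. ws \<noteq> [] \<and> hd ws = r \<and> set ws \<subseteq> V \<and> card (set ws) = Suc k \<and>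
      successively E ws \<and> length ws = Suc (2 * k)" if "k < card V" for k
    using that
  proof (induction k)
    case 0
    show ?case by (rule exI[of _ "[r]"]) (use r in auto)
  next
    case (Suc k)
    then obtain ws where ws: "ws \<noteq> []" "hd ws = r" "set ws \<subseteq> V" "card (set ws) = Suc k"
      "successively E ws" "length ws = Suc (2 * k)" by auto
    have "set ws \<noteq> V" using ws(4) Suc.prems by auto
    then obtain b where b: "b \<in> V" "b \<notin> set ws" using ws(3) by auto
    have "r \<in> set ws" using ws(1,2) by (metis hd_in_set)
    then obtain u v where uv: "u \<in> set ws" "v \<notin> set ws" "E u v"
      using rtranclp_exit[OF conn[OF b(1)] _ b(2)] by metis
    obtain xs ys where split: "ws = xs @ u # ys" using uv(1) by (meson split_list)
    let ?ws = "xs @ u # v # u # ys"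
    have "hd ?ws = r" using ws(1,2) split by (cases xs) auto
    moreover have "successively E ?ws"
      using ws(5) uv(3) E(2)[OF uv(3)] unfolding split
      by (auto simp: successively_append_iff)
    moreover have set: "set ?ws = insert v (set ws)" by (auto simp: split)
    moreover have "card (set ?ws) = Suc (Suc k)" unfolding set using uv(2) ws(4) by simp
    moreover have "set ?ws \<subseteq> V" unfolding set using ws(3) E(1)[OF uv(3)] by simp
    moreover have "length ?ws = Suc (2 * Suc k)" using ws(6) by (simp add: split)
    ultimately show ?case by blast
  qed
  note walk = this
  have pos: "card V > 0" using r fin by (auto simp: card_gt_0_iff)
  then have "\<exists>ws. ws \<noteq> [] \<and> hd ws = r \<and> set ws \<subseteq> V \<and> card (set ws) = Suc (card V - 1) \<and>
      successively E ws \<and> length ws = Suc (2 * (card V - 1))"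
    by (intro walk) simp
  then obtain ws where "ws \<noteq> []" "hd ws = r" "set ws \<subseteq> V"
    "card (set ws) = card V" "successively E ws" "length ws = Suc (2 * (card V - 1))"
    using pos by auto
  moreover from this have "set ws = V" using fin by (metis card_subset_eq)
  ultimately show ?thesis using pos that by auto
qed

section \<open>Self-delimiting codes\<close>

fun unary_code :: "nat list \<Rightarrow> bool list" where
  "unary_code [] = []"
| "unary_code (k # ks) = replicate k True @ False # unary_code ks"

lemma replicate_True_append_inject:
  "replicate k True @ False # xs = replicate l True @ False # ys \<longleftrightarrow> k = l \<and> xs = ys"
  by (induction k arbitrary: l; case_tac l; simp)

lemma unary_code_inject: "unary_code ks = unary_code ls \<longleftrightarrow> ks = ls"
proof (induction ks arbitrary: ls)
  case Nil
  show ?case by (cases ls) auto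
next
  case (Cons k ks)
  then show ?case by (cases ls) (auto simp: replicate_True_append_inject)
qed

lemma length_unary_code: "length (unary_code ks) = sum_list ks + length ks"
  by (induction ks) auto

text \<open>Binary digits, least significant first and ending in 1 unless empty, so the list
  determines the number. Identifiers may reach \<open>n ^ c\<close>, too long for unary.\<close>

fun bits :: "nat \<Rightarrow> nat list" where
  "bits n = (if n = 0 then [] else (n mod 2) # bits (n div 2))"

declare bits.simps [simp del]

lemma bits_inject: "bits a = bits b \<longleftrightarrow> a = b"
proof (induction a arbitrary: b rule: less_induct)
  case (less a)
  show ?case
  proof (cases "a = 0 \<or> b = 0")
    case True
    then show ?thesis by (auto simp: bits.simps[of a] bits.simps[of b])
  next
    case False
    have "bits a = bits b \<longleftrightarrow> a mod 2 = b mod 2 \<and> a div 2 = b div 2"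
      using False less.IH[of "a div 2"] by (simp add: bits.simps[of a] bits.simps[of b])
    also have "\<dots> \<longleftrightarrow> a = b" by (metis div_mult_mod_eq)
    finally show ?thesis .
  qed
qed

lemma length_bits: "a < 2 ^ k \<Longrightarrow> length (bits a) \<le> k"
proof (induction k arbitrary: a)
  case 0
  then show ?case by (simp add: bits.simps)
next
  case (Suc k)
  then show ?case by (subst bits.simps) auto
qed

lemma sum_list_bits: "sum_list (bits a) \<le> length (bits a)"
proof (induction a rule: less_induct)
  case (less a)
  show ?case
  proof (cases "a = 0")
    case False
    then have "sum_list (bits (a div 2)) \<le> length (bits (a div 2))" by (intro less) simp
    moreover have "a mod 2 \<le> 1" by simp
    ultimately show ?thesis using False by (simp add: bits.simps[of a])
  qed (simp add: bits.simps)
qed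

section \<open>Words describing graphs on the grid\<close>

type_synonym location = "int \<times> int"
type_synonym letter = "location \<times> location set"

text \<open>The possible differences between the cells of two touching disks' centres.\<close>

definition offsets :: "location set" where
  "offsets = {-2..2} \<times> {-2..2}"

text \<open>A letter records one step of a walk through grid cells: the displacement from the previous
  cell, and the offsets of the neighbours of the vertex sitting in the cell that is reached.\<close>

definition letters :: "letter set" where
  "letters = offsets \<times> Pow offsets"

lemma finite_letters: "finite letters"
  by (simp add: letters_def offsets_def)

text \<open>The decoder for \<open>walk_word\<close>: displacements are summed to absolute cells,
  one entry per visit.\<close>

fun trace :: "location \<Rightarrow> letter list \<Rightarrow> (location \<times> location set) list" where
  "trace z [] = []"
| "trace z ((d, S) # \<sigma>) = (z + d, S) # trace (z + d) \<sigma>"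

definition loc :: "letter list \<Rightarrow> nat \<Rightarrow> location" where
  "loc \<sigma> i = fst (trace 0 \<sigma> ! i)"

definition locs :: "letter list \<Rightarrow> location set" where
  "locs \<sigma> = fst ` set (trace 0 \<sigma>)"

text \<open>A dishonest word may give a cell different sets at different visits; their union
  counts.\<close>

definition loc_adj :: "letter list \<Rightarrow> location \<Rightarrow> location \<Rightarrow> bool" where
  "loc_adj \<sigma> x y \<longleftrightarrow> (\<exists>S. (x, S) \<in> set (trace 0 \<sigma>) \<and> y - x \<in> S)"

fun walk_word :: "('a \<Rightarrow> location) \<Rightarrow> ('a \<Rightarrow> location set) \<Rightarrow> location \<Rightarrow> 'a list \<Rightarrow> letter list" where
  "walk_word q N z [] = []"
| "walk_word q N z (w # ws) = (q w - z, N w) # walk_word q N (q w) ws"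

lemma trace_walk_word: "trace z (walk_word q N z ws) = map (\<lambda>w. (q w, N w)) ws"
  by (induction ws arbitrary: z) auto

lemma length_walk_word: "length (walk_word q N z ws) = length ws"
  by (induction ws arbitrary: z) auto

lemma length_trace: "length (trace z \<sigma>) = length \<sigma>"
  by (induction z \<sigma> rule: trace.induct) auto

lemma walk_word_letters:
  assumes "successively E ws" "\<And>u v. E u v \<Longrightarrow> q v - q u \<in> offsets"
    "\<And>w. w \<in> set ws \<Longrightarrow> N w \<subseteq> offsets" "ws \<noteq> [] \<Longrightarrow> q (hd ws) - z \<in> offsets"
  shows "set (walk_word q N z ws) \<subseteq> letters"
  using assms
proof (induction ws arbitrary: z)
  case (Cons w ws)
  have "set (walk_word q N (q w) ws) \<subseteq> letters"
    using Cons.prems by (intro Cons.IH) (auto simp: successively_Cons)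
  then show ?case using Cons.prems(3,4) by (auto simp: letters_def)
qed simp

text \<open>A property of the word alone, so each vertex can test it unaided. Reachability of the
  initial cell lets uniqueness of preimages spread from there.\<close>

definition realisable :: "letter list \<Rightarrow> bool" where
  "realisable \<sigma> \<longleftrightarrow>
     (\<exists>p :: location \<Rightarrow> complex. \<forall>x\<in>locs \<sigma>. \<forall>y\<in>locs \<sigma>. x \<noteq> y \<longrightarrow>
        dist (p x) (p y) \<ge> 2 \<and> (loc_adj \<sigma> x y \<longleftrightarrow> dist (p x) (p y) = 2)) \<and>
     (\<forall>x\<in>locs \<sigma>. (loc_adj \<sigma>)\<^sup>*\<^sup>* x (loc \<sigma> 0))"

section \<open>Local checks and covering maps\<close>

type_synonym certificate = "letter list \<times> nat \<times> nat"

text \<open>A certificate (\<sigma>, i, r) consists of the word of the whole graph, a position in its walk at which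
  the vertex is visited, and the identifier of the vertex in the initial cell. The latter makes
  the fibre over the initial cell a singleton, so the covering map onto the decoded graph is injective.\<close>

fun certified :: "nat \<Rightarrow> certificate \<Rightarrow> (nat \<times> certificate) set \<Rightarrow> bool" where
  "certified v (\<sigma>, i, r) M \<longleftrightarrow>
     realisable \<sigma> \<and> i < length \<sigma> \<and> (loc \<sigma> i = loc \<sigma> 0 \<longrightarrow> v = r) \<and>
     (\<forall>(u, \<sigma>', j, r') \<in> M. \<sigma>' = \<sigma> \<and> r' = r) \<and>
     bij_betw (\<lambda>(u, \<sigma>', j, r'). loc \<sigma> j) M {y. loc_adj \<sigma> (loc \<sigma> i) y}"

text \<open>Induction along a path from \<open>a\<close> to \<open>s\<close>: two vertices over
  \<open>a\<close> have neighbours over the next point \<open>b\<close>, which by induction are one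
  vertex \<open>w\<close>. Both are then neighbours of \<open>w\<close> with the same image, and
  \<open>f\<close> is injective on neighbourhoods.\<close>

lemma covering_inj:
  assumes "symp E" and E: "\<And>u v. E u v \<Longrightarrow> u \<in> V \<and> v \<in> V"
    and bij: "\<And>v. v \<in> V \<Longrightarrow> bij_betw f {u. E v u} {y. F (f v) y}"
    and conn: "\<And>v. v \<in> V \<Longrightarrow> F\<^sup>*\<^sup>* (f v) s"
    and fibre: "\<And>u v. u \<in> V \<Longrightarrow> v \<in> V \<Longrightarrow> f u = s \<Longrightarrow> f v = s \<Longrightarrow> u = v"
  shows "inj_on f V"
proof -
  have "\<forall>u\<in>V. \<forall>v\<in>V. f u = a \<longrightarrow> f v = a \<longrightarrow> u = v" if "F\<^sup>*\<^sup>* a s" for a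
    using that
  proof (induction rule: converse_rtranclp_induct)
    case base
    then show ?case using fibre by blast
  next
    case (step a b)
    show ?case
    proof (intro ballI impI)
      fix u v assume uv: "u \<in> V" "v \<in> V" "f u = a" "f v = a"
      have "b \<in> f ` {w. E u w}" "b \<in> f ` {w. E v w}"
        using bij_betw_imp_surj_on[OF bij[OF uv(1)]] bij_betw_imp_surj_on[OF bij[OF uv(2)]] uv step(1)
        by auto
      then obtain w w' where w: "E u w" "f w = b" "E v w'" "f w' = b" by auto
      then have "w = w'" using step.IH E by blast
      then have "u \<in> {z. E w z}" "v \<in> {z. E w z}" using w \<open>symp E\<close> by (auto dest: sympD)
      moreover have "inj_on f {z. E w z}" using bij E w(1) by (blast dest: bij_betw_imp_inj_on)
      ultimately show "u = v" using uv by (auto dest: inj_onD)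
    qed
  qed
  then show ?thesis using conn by (auto simp: inj_on_def)
qed

text \<open>Connectedness makes the word and the root identifier common to all vertices. The cell
  map \<open>f\<close> is then an injective covering, so it embeds the graph as an induced subgraph
  and the placement of cells pulls back.\<close>

lemma certified_sound:
  assumes adm: "admissible_graph c V E"
    and cert: "\<And>v. v \<in> V \<Longrightarrow> certified v (t v) {(u, t u) |u. u \<in> V \<and> E v u}"
  shows "penny_graph V E"
proof -
  have E: "\<And>u v. E u v \<Longrightarrow> u \<in> V \<and> v \<in> V" "symp E" "\<And>u v. u \<in> V \<Longrightarrow> v \<in> V \<Longrightarrow> E\<^sup>*\<^sup>* u v"
    using adm by (auto simp: admissible_graph_def symp_def)
  obtain v0 where v0: "v0 \<in> V" using adm by (auto simp: admissible_graph_def)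
  define \<sigma> r where "\<sigma> = fst (t v0)" and "r = snd (snd (t v0))"
  define idx where "idx v = fst (snd (t v))" for v
  have same: "fst (t v) = fst (t u) \<and> snd (snd (t v)) = snd (snd (t u))" if "E u v" for u v
    using cert[of u] E(1)[OF that] that by (cases "t u"; cases "t v") force
  have "fst (t v) = \<sigma> \<and> snd (snd (t v)) = r" if "v \<in> V" for v
    using E(3)[OF v0 that]
  proof (induction rule: rtranclp_induct)
    case base
    show ?case by (simp add: \<sigma>_def r_def)
  next
    case (step y z)
    then show ?case using same[of y z] by simp
  qed
  then have t: "t v = (\<sigma>, idx v, r)" if "v \<in> V" for v
    using that by (simp add: idx_def prod_eq_iff)
  define f where "f v = loc \<sigma> (idx v)" for v
  have real: "realisable \<sigma>" using cert[OF v0] t[OF v0] by simp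
  have root: "v = r" if "v \<in> V" "f v = loc \<sigma> 0" for v
    using cert[OF that(1)] t[OF that(1)] that(2) by (simp add: f_def)
  have in_locs: "f v \<in> locs \<sigma>" if "v \<in> V" for v
    using cert[OF that] t[OF that] by (auto simp: f_def loc_def locs_def length_trace)
  have bij: "bij_betw f {u. E v u} {y. loc_adj \<sigma> (f v) y}" if v: "v \<in> V" for v
  proof -
    let ?M = "{(u, t u) |u. u \<in> V \<and> E v u}"
    let ?g = "\<lambda>(u, \<sigma>', j, r' :: nat). loc \<sigma> j"
    have "bij_betw ?g ?M {y. loc_adj \<sigma> (f v) y}"
      using cert[OF v] t[OF v] by (simp add: f_def)
    moreover have "bij_betw (\<lambda>u. (u, t u)) {u. E v u} ?M"
      using E(1) by (auto simp: bij_betw_def inj_on_def)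
    ultimately have "bij_betw (?g \<circ> (\<lambda>u. (u, t u))) {u. E v u} {y. loc_adj \<sigma> (f v) y}"
      by (rule bij_betw_trans[rotated])
    moreover have "(?g \<circ> (\<lambda>u. (u, t u))) u = f u" if "u \<in> {u. E v u}" for u
      using t E(1) that by (auto simp: f_def)
    ultimately show ?thesis using bij_betw_cong by (metis (mono_tags, lifting))
  qed
  have inj: "inj_on f V"
  proof (rule covering_inj[OF E(2,1) bij])
    show "(loc_adj \<sigma>)\<^sup>*\<^sup>* (f v) (loc \<sigma> 0)" if "v \<in> V" for v
      using real in_locs[OF that] by (auto simp: realisable_def)
    show "u = v" if "u \<in> V" "v \<in> V" "f u = loc \<sigma> 0" "f v = loc \<sigma> 0" for u v
      using root[OF that(1,3)] root[OF that(2,4)] by simp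
  qed
  obtain p :: "location \<Rightarrow> complex" where p: "\<And>x y. x \<in> locs \<sigma> \<Longrightarrow> y \<in> locs \<sigma> \<Longrightarrow> x \<noteq> y \<Longrightarrow>
        dist (p x) (p y) \<ge> 2 \<and> (loc_adj \<sigma> x y \<longleftrightarrow> dist (p x) (p y) = 2)"
    using real unfolding realisable_def by blast
  have adj: "E u v \<longleftrightarrow> loc_adj \<sigma> (f u) (f v)" if uv: "u \<in> V" "v \<in> V" for u v
  proof
    assume "E u v"
    then show "loc_adj \<sigma> (f u) (f v)" using bij_betw_imp_surj_on[OF bij[OF uv(1)]] by auto
  next
    \<comment> \<open>Some neighbour of \<open>u\<close> lies over \<open>f v\<close>; injectivity
      identifies it with \<open>v\<close>.\<close>
    assume "loc_adj \<sigma> (f u) (f v)"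
    then obtain w where "E u w" "f w = f v"
      using bij_betw_imp_surj_on[OF bij[OF uv(1)]] by (metis (mono_tags, lifting) image_iff mem_Collect_eq)
    then show "E u v" using inj E(1) uv by (metis inj_onD)
  qed
  show ?thesis
    unfolding penny_graph_def
  proof (intro exI[of _ "p \<circ> f"] conjI ballI impI)
    fix u v assume uv: "u \<in> V" "v \<in> V" "u \<noteq> v"
    then have "f u \<noteq> f v" using inj by (meson inj_onD)
    from p[OF in_locs[OF uv(1)] in_locs[OF uv(2)] this] adj[OF uv(1,2)]
    show "2 \<le> dist ((p \<circ> f) u) ((p \<circ> f) v)" "E u v \<longleftrightarrow> dist ((p \<circ> f) u) ((p \<circ> f) v) = 2" by auto
  qed
qed


section \<open>Grid cells of disk centres\<close>

lemma floor_diff_bounds: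
  fixes x y :: real
  assumes "\<bar>y - x\<bar> \<le> 2"
  shows "\<lfloor>y\<rfloor> - \<lfloor>x\<rfloor> \<in> {-2..2}"
proof -
  have "y \<le> x + 2" "x \<le> y + 2" using assms by auto
  then have "\<lfloor>y\<rfloor> \<le> \<lfloor>x + 2\<rfloor>" "\<lfloor>x\<rfloor> \<le> \<lfloor>y + 2\<rfloor>" by (intro floor_mono; simp)+
  then show ?thesis by simp
qed

definition cell :: "complex \<Rightarrow> location" where
  "cell z = (\<lfloor>Re z\<rfloor>, \<lfloor>Im z\<rfloor>)"

text \<open>In a unit cell both coordinates differ by less than 1, and the modulus is at most their
  sum. Hence centres of distinct disks get distinct cells.\<close>

lemma cell_eq_imp_dist:
  assumes "cell z = cell w"
  shows "dist z w < 2"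
proof -
  have "\<lfloor>Re z\<rfloor> = \<lfloor>Re w\<rfloor>" "\<lfloor>Im z\<rfloor> = \<lfloor>Im w\<rfloor>" using assms by (auto simp: cell_def)
  then have "\<bar>Re (z - w)\<bar> < 1" "\<bar>Im (z - w)\<bar> < 1"
    using floor_correct[of "Re z"] floor_correct[of "Re w"] floor_correct[of "Im z"] floor_correct[of "Im w"]
    unfolding abs_less_iff minus_complex.simps by linarith+
  then show ?thesis using cmod_le[of "z - w"] by (simp add: dist_norm)
qed

lemma cell_diff_offsets:
  assumes "dist z w \<le> 2"
  shows "cell w - cell z \<in> offsets"
proof -
  have "\<bar>Re w - Re z\<bar> \<le> 2" "\<bar>Im w - Im z\<bar> \<le> 2"
    using assms abs_Re_le_cmod[of "w - z"] abs_Im_le_cmod[of "w - z"]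
    by (simp_all add: dist_norm norm_minus_commute)
  then show ?thesis
    using floor_diff_bounds[of "Re w" "Re z"] floor_diff_bounds[of "Im w" "Im z"]
    unfolding cell_def offsets_def by simp
qed

definition short_certificate :: "nat set \<Rightarrow> certificate \<Rightarrow> bool" where
  "short_certificate V = (\<lambda>(\<sigma>, i, r). set \<sigma> \<subseteq> letters \<and> length \<sigma> \<le> 2 * card V \<and> i < length \<sigma> \<and> r \<in> V)"

lemma certified_complete:
  assumes adm: "admissible_graph c V E" and penny: "penny_graph V E"
  shows "\<exists>t. \<forall>v\<in>V. certified v (t v) {(u, t u) |u. u \<in> V \<and> E v u} \<and> short_certificate V (t v)"
proof -
  have E: "\<And>u v. E u v \<Longrightarrow> u \<in> V \<and> v \<in> V" "\<And>u v. E u v \<Longrightarrow> E v u"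
    "\<And>u v. u \<in> V \<Longrightarrow> v \<in> V \<Longrightarrow> E\<^sup>*\<^sup>* u v" and irrefl: "\<And>v. \<not> E v v" and fin: "finite V"
    using adm by (auto simp: admissible_graph_def)
  obtain r where r: "r \<in> V" using adm by (auto simp: admissible_graph_def)
  obtain p :: "nat \<Rightarrow> complex" where "\<forall>u\<in>V. \<forall>v\<in>V. u \<noteq> v \<longrightarrow> dist (p u) (p v) \<ge> 2"
    "\<forall>u\<in>V. \<forall>v\<in>V. u \<noteq> v \<longrightarrow> (E u v \<longleftrightarrow> dist (p u) (p v) = 2)"
    using penny unfolding penny_graph_def by blast
  then have p: "dist (p u) (p v) \<ge> 2 \<and> (E u v \<longleftrightarrow> dist (p u) (p v) = 2)"
    if "u \<in> V" "v \<in> V" "u \<noteq> v" for u v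
    using that by simp
  \<comment> \<open>Shifted so that the root sits at the origin, where \<open>trace 0\<close>
    starts; the first displacement is therefore 0.\<close>
  define q where "q v = cell (p v) - cell (p r)" for v
  have inj: "inj_on q V"
  proof (rule inj_onI, rule ccontr)
    fix u v assume "u \<in> V" "v \<in> V" "q u = q v" "u \<noteq> v"
    then show False using p[of u v] cell_eq_imp_dist[of "p u" "p v"] by (simp add: q_def)
  qed
  have q_adj: "q v - q u \<in> offsets" if "E u v" for u v
  proof -
    have "dist (p u) (p v) = 2" using p[of u v] E(1)[OF that] irrefl that by metis
    then show ?thesis using cell_diff_offsets[of "p u" "p v"] by (simp add: q_def)
  qed
  define N where "N v = {q u - q v |u. E v u}" for v
  obtain ws where ws: "ws \<noteq> []" "hd ws = r" "set ws = V" "successively E ws" "length ws \<le> 2 * card V"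
    using covering_walk[OF fin r E(1,2) E(3)[OF r]] by metis
  define \<sigma> where "\<sigma> = walk_word q N 0 ws"
  have len: "length \<sigma> = length ws" by (simp add: \<sigma>_def length_walk_word)
  have tr: "trace 0 \<sigma> = map (\<lambda>w. (q w, N w)) ws" by (simp add: \<sigma>_def trace_walk_word)
  have letters: "set \<sigma> \<subseteq> letters"
    unfolding \<sigma>_def
  proof (rule walk_word_letters[OF ws(4) q_adj])
    show "N w \<subseteq> offsets" for w using q_adj by (auto simp: N_def)
    show "q (hd ws) - 0 \<in> offsets" by (simp add: ws(2) q_def offsets_def zero_prod_def)
  qed
  \<comment> \<open>The walk may visit a vertex repeatedly; any visit will do.\<close>
  define idx where "idx v = (SOME i. i < length ws \<and> ws ! i = v)" for v
  have idx: "idx v < length ws" "ws ! idx v = v" if "v \<in> V" for v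
    using someI_ex[of "\<lambda>i. i < length ws \<and> ws ! i = v"] that ws(3)
    by (auto simp: idx_def in_set_conv_nth)
  have loc: "loc \<sigma> i = q (ws ! i)" if "i < length ws" for i
    using that by (simp add: loc_def tr)
  have loc_idx: "loc \<sigma> (idx v) = q v" if "v \<in> V" for v
    using loc idx[OF that] by simp
  have loc_0: "loc \<sigma> 0 = q r" using loc[of 0] ws(1,2) by (simp add: hd_conv_nth)
  have locs: "locs \<sigma> = q ` V" using ws(3) by (auto simp: locs_def tr image_image)
  have adj: "{y. loc_adj \<sigma> (q v) y} = q ` {u. E v u}" if v: "v \<in> V" for v
  proof -
    \<comment> \<open>As \<open>q\<close> is injective, all visits to the cell \<open>q v\<close>
      record the same set \<open>N v\<close>.\<close>
    have "loc_adj \<sigma> (q v) y \<longleftrightarrow> y - q v \<in> N v" for y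
      using inj v ws(3) by (auto simp: loc_adj_def tr dest: inj_onD)
    then show ?thesis by (auto simp: N_def image_iff)
  qed
  have adj_iff: "loc_adj \<sigma> (q u) (q v) \<longleftrightarrow> E u v" if "u \<in> V" "v \<in> V" for u v
  proof -
    have "loc_adj \<sigma> (q u) (q v) \<longleftrightarrow> q v \<in> q ` {w. E u w}" using adj[OF that(1)] by blast
    also have "\<dots> \<longleftrightarrow> v \<in> {w. E u w}" using inj that(2) E(1) by (intro inj_on_image_mem_iff) auto
    finally show ?thesis by simp
  qed
  have reach: "(loc_adj \<sigma>)\<^sup>*\<^sup>* (q u) (q v)" if "E\<^sup>*\<^sup>* u v" for u v
    using that
  proof (induction rule: rtranclp_induct)
    case (step y z)
    then show ?case using adj_iff E(1) by (meson rtranclp.rtrancl_into_rtrancl)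
  qed simp
  have real: "realisable \<sigma>"
    unfolding realisable_def
  proof
    show "\<exists>p :: location \<Rightarrow> complex. \<forall>x\<in>locs \<sigma>. \<forall>y\<in>locs \<sigma>. x \<noteq> y \<longrightarrow>
        dist (p x) (p y) \<ge> 2 \<and> (loc_adj \<sigma> x y \<longleftrightarrow> dist (p x) (p y) = 2)"
      using p adj_iff inj by (intro exI[of _ "p \<circ> the_inv_into V q"]) (auto simp: locs the_inv_into_f_f)
    show "\<forall>x\<in>locs \<sigma>. (loc_adj \<sigma>)\<^sup>*\<^sup>* x (loc \<sigma> 0)"
      using reach E(3) r by (auto simp: locs loc_0)
  qed
  define t where "t v = (\<sigma>, idx v, r)" for v
  show ?thesis
  proof (intro exI[of _ t] ballI conjI)
    fix v assume v: "v \<in> V"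
    show "short_certificate V (t v)"
      using letters ws(5) idx[OF v] r by (simp add: t_def short_certificate_def len)
    let ?M = "{(u, t u) |u. u \<in> V \<and> E v u}"
    have M: "?M = (\<lambda>u. (u, t u)) ` {u. E v u}" using E(1) by auto
    have "bij_betw (\<lambda>(u, \<sigma>', j, r' :: nat). loc \<sigma> j) ?M (q ` {u. E v u})"
    proof (rule bij_betw_imageI)
      show "inj_on (\<lambda>(u, \<sigma>', j, r' :: nat). loc \<sigma> j) ?M"
        using inj loc_idx by (auto simp: inj_on_def t_def)
      show "(\<lambda>(u, \<sigma>', j, r' :: nat). loc \<sigma> j) ` ?M = q ` {u. E v u}"
        unfolding M image_image using loc_idx E(1) by (intro image_cong) (auto simp: t_def)
    qed
    moreover have "q v = q r \<longrightarrow> v = r" using inj v r by (auto dest: inj_onD)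
    ultimately show "certified v (t v) ?M"
      using real idx[OF v] loc_idx[OF v] adj[OF v] by (auto simp: t_def len loc_0)
  qed
qed

section \<open>Certificates as binary words\<close>

text \<open>An arbitrary numbering of an alphabet independent of the graph, so a letter has constant
  cost even in unary.\<close>

definition letter_index :: "letter \<Rightarrow> nat" where
  "letter_index = (SOME f. inj_on f letters)"

lemma inj_letter_index: "inj_on letter_index letters"
  unfolding letter_index_def
  using finite_imp_inj_to_nat_seg[OF finite_letters] by (metis someI_ex)

text \<open>The length of the word shows where the letters end and the digits of \<open>r\<close>
  begin.\<close>

definition encode :: "certificate \<Rightarrow> bool list" where
  "encode = (\<lambda>(\<sigma>, i, r). unary_code (i # length \<sigma> # map letter_index \<sigma> @ bits r))"

lemma inj_encode: "inj_on encode {(\<sigma>, i, r). set \<sigma> \<subseteq> letters}"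
proof -
  have "\<sigma> = \<sigma>'" if "map letter_index \<sigma> = map letter_index \<sigma>'" "set \<sigma> \<subseteq> letters" "set \<sigma>' \<subseteq> letters" for \<sigma> \<sigma>'
    using that inj_on_map_eq_map[OF inj_on_subset[OF inj_letter_index], of \<sigma> \<sigma>'] by simp
  then show ?thesis
    by (auto simp: inj_on_def encode_def unary_code_inject bits_inject simp del: unary_code.simps)
qed

text \<open>Words outside the range of \<open>encode\<close> decode arbitrarily, which is harmless
  because soundness covers every assignment of certificates.\<close>

definition decode :: "bool list \<Rightarrow> certificate" where
  "decode = inv_into {(\<sigma>, i, r). set \<sigma> \<subseteq> letters} encode"

lemma decode_encode: "short_certificate V t \<Longrightarrow> decode (encode t) = t"
  unfolding decode_def by (rule inv_into_f_f[OF inj_encode]) (auto simp: short_certificate_def)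

lemma length_encode:
  assumes "short_certificate V t" "V \<subseteq> {1..card V ^ c}"
  shows "length (encode t) \<le> (2 * Max (letter_index ` letters) + 2 * c + 10) * card V"
proof -
  obtain \<sigma> i r where t: "t = (\<sigma>, i, r)" by (cases t)
  define n K where "n = card V" and "K = Max (letter_index ` letters)"
  have *: "set \<sigma> \<subseteq> letters" "length \<sigma> \<le> 2 * n" "i < length \<sigma>" "r \<in> V"
    using assms(1) by (auto simp: t short_certificate_def n_def)
  have "sum_list (map letter_index \<sigma>) \<le> sum_list (map (\<lambda>_. K) \<sigma>)"
    using *(1) finite_letters by (intro sum_list_mono) (auto simp: K_def)
  also have "\<dots> \<le> K * (2 * n)" using *(2) by (simp add: sum_list_triv)
  finally have s: "sum_list (map letter_index \<sigma>) \<le> 2 * K * n" by simp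
  have "n > 0" using *(2,3) by simp
  have "r \<le> n ^ c" using *(4) assms(2) by (auto simp: n_def)
  \<comment> \<open>This crude estimate suffices: the identifier may take linearly many
    digits.\<close>
  also have "n ^ c \<le> (2 ^ n) ^ c" by (intro power_mono) (simp_all add: less_imp_le)
  also have "\<dots> < 2 ^ (c * n + 1)" by (simp add: mult.commute flip: power_mult)
  finally have "r < 2 ^ (c * n + 1)" .
  then have "length (bits r) \<le> c * n + 1" by (rule length_bits)
  moreover have "length (encode t) \<le> i + length \<sigma> + (2 * K * n + length (bits r)) + (2 + length \<sigma> + length (bits r))"
    using s sum_list_bits[of r] by (simp add: encode_def t length_unary_code)
  ultimately have "length (encode t) \<le> 2 * K * n + 2 * (c * n) + 6 * n + 4"
    using *(2,3) by linarith
  moreover have "6 * n + 4 \<le> 10 * n" using \<open>n > 0\<close> by simp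
  ultimately have "length (encode t) \<le> 2 * K * n + 2 * (c * n) + 10 * n" by linarith
  then show ?thesis by (simp add: n_def K_def algebra_simps)
qed

section \<open>The scheme and its cost\<close>

definition penny_verifier :: verifier where
  "penny_verifier v w M \<longleftrightarrow> certified v (decode w) ((\<lambda>(u, w). (u, decode w)) ` M)"

definition penny_prover :: prover where
  "penny_prover V E = encode \<circ> (SOME t. \<forall>v\<in>V.
     certified v (t v) {(u, t u) |u. u \<in> V \<and> E v u} \<and> short_certificate V (t v))"

lemma penny_prover:
  assumes "admissible_graph c V E" "penny_graph V E"
  shows "\<exists>t. penny_prover V E = encode \<circ> t \<and>
    (\<forall>v\<in>V. certified v (t v) {(u, t u) |u. u \<in> V \<and> E v u} \<and> short_certificate V (t v))"
  using someI_ex[OF certified_complete[OF assms]] unfolding penny_prover_def by blast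

lemma all_accept_penny_verifier:
  "all_accept penny_verifier V E cert \<longleftrightarrow>
     (\<forall>v\<in>V. certified v (decode (cert v)) {(u, decode (cert u)) |u. u \<in> V \<and> E v u})"
proof -
  have "(\<lambda>(u, w). (u, decode w)) ` {(u, cert u) |u. u \<in> V \<and> E v u} =
      {(u, decode (cert u)) |u. u \<in> V \<and> E v u}" for v
    by (auto simp: image_iff)
  then show ?thesis by (simp add: all_accept_def penny_verifier_def)
qed

lemma penny_pls_exists: "penny_pls c penny_prover penny_verifier"
  unfolding penny_pls_def
proof (intro allI impI conjI)
  fix V E assume adm: "admissible_graph c V E" and penny: "penny_graph V E"
  obtain t where t: "penny_prover V E = encode \<circ> t"
    "\<And>v. v \<in> V \<Longrightarrow> certified v (t v) {(u, t u) |u. u \<in> V \<and> E v u}"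
    "\<And>v. v \<in> V \<Longrightarrow> short_certificate V (t v)"
    using penny_prover[OF adm penny] by blast
  have dec: "decode (penny_prover V E v) = t v" if "v \<in> V" for v
    using decode_encode[OF t(3)[OF that]] by (simp add: t(1))
  then have "{(u, decode (penny_prover V E u)) |u. u \<in> V \<and> E v u} = {(u, t u) |u. u \<in> V \<and> E v u}" for v
    by (intro Collect_cong) metis
  then show "all_accept penny_verifier V E (penny_prover V E)"
    using t(2) dec by (simp add: all_accept_penny_verifier)
next
  fix V E cert assume adm: "admissible_graph c V E" and no: "\<not> penny_graph V E"
  show "\<not> all_accept penny_verifier V E cert"
    using certified_sound[OF adm, of "\<lambda>v. decode (cert v)"] no
    by (auto simp: all_accept_penny_verifier)
qed

lemma cert_bound_penny_prover:
  "cert_bound c penny_prover n ((2 * Max (letter_index ` letters) + 2 * c + 10) * n)"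
  unfolding cert_bound_def
proof (intro allI impI ballI)
  fix V E v assume "admissible_graph c V E \<and> penny_graph V E \<and> card V = n" and v: "v \<in> V"
  then have *: "admissible_graph c V E" "penny_graph V E" "card V = n" by auto
  obtain t where t: "penny_prover V E = encode \<circ> t" "\<And>v. v \<in> V \<Longrightarrow> short_certificate V (t v)"
    using penny_prover[OF *(1,2)] by blast
  show "length (penny_prover V E v) \<le> (2 * Max (letter_index ` letters) + 2 * c + 10) * n"
    using length_encode[OF t(2)[OF v], of c] * by (simp add: t(1) admissible_graph_def)
qed

theorem theorem5p2:
  fixes c :: nat
  assumes "c \<ge> 1"
  shows "\<exists>a b :: real. \<exists>N :: nat. a > 0 \<and> b > 0 \<and>
           (\<forall>n \<ge> N. a * real n \<le> real (penny_local_complexity c n) \<and>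
                     real (penny_local_complexity c n) \<le> b * real n)"
proof -
  define B where "B = 2 * Max (letter_index ` letters) + 2 * c + 10"
  have upper: "\<exists>P A. penny_pls c P A \<and> cert_bound c P n (B * n)" for n
    using penny_pls_exists cert_bound_penny_prover unfolding B_def by blast
  have "1 / 144 * real n \<le> real (penny_local_complexity c n) \<and>
      real (penny_local_complexity c n) \<le> real B * real n" if n: "n \<ge> 220" for n
  proof
    let ?k = "penny_local_complexity c n"
    have "?k \<le> B * n"
      unfolding penny_local_complexity_def using upper by (rule Least_le)
    then show "real ?k \<le> real B * real n" by (simp flip: of_nat_mult)
    have "\<exists>P A. penny_pls c P A \<and> cert_bound c P n ?k"
      unfolding penny_local_complexity_def using upper by (rule LeastI)
    then obtain P A where "penny_pls c P A" "cert_bound c P n ?k" by blast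
    then have m: "m \<le> 4 * (?k + 1)" if "18 * m + 20 \<le> n" for m
      using that by (intro cert_bound_lower[OF assms]) auto
    \<comment> \<open>The largest admissible \<open>m\<close>. With
      \<open>m \<le> 4 * (?k + 1)\<close> it gives \<open>n < 72 * ?k + 110\<close>, and
      \<open>n \<ge> 220\<close> makes 110 at most half of \<open>n\<close>, whence the factor
      144.\<close>
    obtain m where "18 * m + 20 \<le> n" "n < 18 * m + 38"
    proof
      show "18 * ((n - 20) div 18) + 20 \<le> n" "n < 18 * ((n - 20) div 18) + 38"
        using n by presburger+
    qed
    with m[of m] n have "n \<le> 144 * ?k" by simp
    then show "1 / 144 * real n \<le> real ?k" by simp
  qed
  then show ?thesis
    by (intro exI[of _ "1 / 144"] exI[of _ "real B"] exI[of _ 220]) (auto simp: B_def)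
qed

end
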